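(* Let $\mathbf{J}\sim\mathcal{N}(\mu,C)$ on $\mathbb{R}^d$, where $C$ is the rational quadratic covariance $$C\bigl(\tfrac{\|x-y\|^2}{2}\bigr)=\sigma^2\Bigl(1+\frac{\|x-y\|^2}{\beta s^2}\Bigr)^{-\beta/2},\qquad \beta>0,\ s>0,\ \sigma^2>0.$$ Then for $\Theta=\frac{\|\nabla\mathbf{J}(w)\|}{\mu-\mathbf{J}(w)}>0$ the RFD step size is given by $$\eta^*=s\sqrt{\beta}\,\operatorname{Root}_{\eta}\Bigl(-1+\tfrac{\sqrt\beta}{s\Theta}\eta+(1+\beta)\eta^2+\tfrac{\sqrt\beta}{s\Theta}\eta^3\Bigr),$$ where $\operatorname{Root}_\eta$ denotes the unique positive root of the polynomial in $\eta$; this root is contained in $[0,1/\sqrt{1+\beta}]$.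
   Context: $\mathbf{J}\sim\mathcal{N}(\mu,C)$ means that $\mathbf{J}$ is a Gaussian random function on $\mathbb{R}^d$ (with differentiable sample paths) with $\mathbb{E}[\mathbf{J}(w)]=\mu$ and $\operatorname{Cov}(\mathbf{J}(w),\mathbf{J}(\tilde w))=C\bigl(\tfrac{\|w-\tilde w\|^2}{2}\bigr)$. The point $w$ is deterministic, with $\mathbf{J}(w)<\mu$ and $\nabla\mathbf{J}(w)\neq0$. The RFD step size is $$\eta^*:=\operatorname*{argmin}_{\eta\in\mathbb{R}}\ -\frac{C(\eta^2/2)}{C(0)}-\eta\,\frac{C'(\eta^2/2)}{C'(0)}\,\Theta .$$ *)

theory Defs
  imports "HOL-Probability.Probability" "HOL-Computational_Algebra.Polynomial"
begin

text \<open>Normal laws of variance zero are included: an almost surely constant random variable is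
  Gaussian.\<close>

definition gaussian_variable :: "'w measure \<Rightarrow> ('w \<Rightarrow> real) \<Rightarrow> bool" where
  "gaussian_variable M X \<longleftrightarrow>
     X \<in> borel_measurable M \<and>
     ((\<exists>m. AE \<omega> in M. X \<omega> = m) \<or>
      (\<exists>m s. s > 0 \<and> distributed M lborel X (normal_density m s)))"

text \<open>Joint Gaussianity of the finite-dimensional distributions is expressed by requiring every
  finite linear combination of evaluations to be Gaussian.\<close>

definition gaussian_random_function ::
    "'w measure \<Rightarrow> (real ^ 'n \<Rightarrow> 'w \<Rightarrow> real) \<Rightarrow> bool" where
  "gaussian_random_function M J \<longleftrightarrow>
     (\<forall>A a. finite A \<longrightarrow> gaussian_variable M (\<lambda>\<omega>. \<Sum>x\<in>A. a x * J x \<omega>))"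

definition covariance :: "'w measure \<Rightarrow> ('w \<Rightarrow> real) \<Rightarrow> ('w \<Rightarrow> real) \<Rightarrow> real" where
  "covariance M X Y =
     (LINT \<omega>|M. (X \<omega> - (LINT \<omega>'|M. X \<omega>')) * (Y \<omega> - (LINT \<omega>'|M. Y \<omega>')))"

text \<open>The relation \<open>J \<sim> \<N>(\<mu>, C)\<close>. Only the values of \<open>C\<close> on \<open>[0, \<infinity>)\<close> matter.\<close>

definition isotropic_gaussian ::
    "'w measure \<Rightarrow> (real ^ 'n \<Rightarrow> 'w \<Rightarrow> real) \<Rightarrow> real \<Rightarrow> (real \<Rightarrow> real) \<Rightarrow> bool" where
  "isotropic_gaussian M J \<mu> C \<longleftrightarrow>
     gaussian_random_function M J \<and>
     (\<forall>\<omega>\<in>space M. \<forall>x. (\<lambda>y. J y \<omega>) differentiable (at x)) \<and>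
     (\<forall>x. (LINT \<omega>|M. J x \<omega>) = \<mu>) \<and>
     (\<forall>x y. covariance M (J x) (J y) = C ((norm (x - y))\<^sup>2 / 2))"

definition gradient :: "('a::real_inner \<Rightarrow> real) \<Rightarrow> 'a \<Rightarrow> 'a" where
  "gradient f x = (THE D. GDERIV f x :> D)"

text \<open>\<open>C\<close> lives on \<open>[0, \<infinity>)\<close>, so its derivative at 0 is one-sided.\<close>

definition kernel_deriv :: "(real \<Rightarrow> real) \<Rightarrow> real \<Rightarrow> real" where
  "kernel_deriv C h = vector_derivative C (at h within {0..})"

definition rfd_objective :: "(real \<Rightarrow> real) \<Rightarrow> real \<Rightarrow> real \<Rightarrow> real" where
  "rfd_objective C \<Theta> \<eta> =
     - (C (\<eta>\<^sup>2 / 2) / C 0) - \<eta> * (kernel_deriv C (\<eta>\<^sup>2 / 2) / kernel_deriv C 0) * \<Theta>"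

definition is_rfd_step_size :: "(real \<Rightarrow> real) \<Rightarrow> real \<Rightarrow> real \<Rightarrow> bool" where
  "is_rfd_step_size C \<Theta> \<eta> \<longleftrightarrow> is_arg_min (rfd_objective C \<Theta>) (\<lambda>_. True) \<eta>"

text \<open>Meaningful only for polynomials with exactly one positive root.\<close>

definition positive_root :: "real poly \<Rightarrow> real" where
  "positive_root p = (THE x. x > 0 \<and> poly p x = 0)"

end

theory Submission
  imports Defs
begin

text \<open>
  The randomness enters only through \<open>\<Theta>\<close>, which is a fixed positive number once the sample point
  is fixed; what remains is a one-variable minimisation.  Measured in units of \<open>s * sqrt \<beta>\<close>, with
  \<open>\<eta> = s * sqrt \<beta> * x\<close> and \<open>k = \<Theta> * s * sqrt \<beta>\<close>, the objective becomes
  \<open>- (1 + x\<^sup>2) powr (- \<beta> / 2) - k * x * (1 + x\<^sup>2) powr (- \<beta> / 2 - 1)\<close>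
  (\<open>rfd_objective_rational_quadratic\<close>).  The factor \<open>k * (1 + x\<^sup>2) powr (- \<beta> / 2 - 2)\<close> of its
  derivative is positive, and the other factor is the cubic of the theorem
  (\<open>scaled_objective_deriv\<close>).  All coefficients of the cubic but the constant one are positive, so
  on the nonnegative half-line it increases strictly from \<open>-1\<close> and changes sign exactly once
  (\<open>cubic_sign_change\<close>): the objective decreases before the root and increases after it.  A
  negative \<open>x\<close> is never better than \<open>- x\<close>, because the first summand is even and the second one odd
  (\<open>scaled_objective_strict_min\<close>).
\<close>

section \<open>The cubic\<close>

text \<open>At \<open>1 / sqrt b\<close> the quadratic term alone cancels the constant \<open>-1\<close>, and the two odd terms are
  positive there; this is what bounds the root.\<close>

lemma cubic_sign_change:
  fixes a b :: real
  assumes "a > 0" "b > 0"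
  obtains r where "0 < r" "r < 1 / sqrt b" "poly [:-1, a, b, a:] r = 0"
    and "\<And>x. 0 \<le> x \<Longrightarrow> x < r \<Longrightarrow> poly [:-1, a, b, a:] x < 0"
    and "\<And>x. r < x \<Longrightarrow> poly [:-1, a, b, a:] x > 0"
proof -
  let ?p = "[:-1, a, b, a:]"
  have mono: "poly ?p x < poly ?p y" if "0 \<le> x" "x < y" for x y
  proof -
    have "x * (a + x * (b + x * a)) < y * (a + y * (b + y * a))"
      using that assms by (intro mult_strict_mono add_strict_left_mono mult_strict_right_mono)
        (auto intro!: add_pos_nonneg add_nonneg_nonneg mult_nonneg_nonneg)
    then show ?thesis by simp
  qed
  let ?u = "1 / sqrt b"
  have u: "?u > 0" "b * ?u\<^sup>2 = 1"
    using assms by (simp_all add: power_divide)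
  have "poly ?p ?u = b * ?u\<^sup>2 - 1 + a * ?u + a * ?u ^ 3"
    by (simp add: algebra_simps power2_eq_square power3_eq_cube)
  also have "\<dots> = a * ?u + a * ?u ^ 3"
    using u by simp
  also have "\<dots> > 0"
    using u assms by (intro add_pos_pos mult_pos_pos zero_less_power) auto
  finally obtain r where r: "0 < r" "r < ?u" "poly ?p r = 0"
    using poly_IVT_pos[of 0 ?u ?p] u by auto
  have neg: "poly ?p x < 0" if "0 \<le> x" "x < r" for x
    using mono[OF that] r by linarith
  have pos: "poly ?p x > 0" if "r < x" for x
    using mono[OF less_imp_le[OF r(1)] that] r by linarith
  show thesis by (rule that[OF r neg pos])
qed

section \<open>The objective in scaled coordinates\<close>

definition scaled_objective :: "real \<Rightarrow> real \<Rightarrow> real \<Rightarrow> real" where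
  "scaled_objective \<beta> k x =
     - ((1 + x\<^sup>2) powr (- \<beta> / 2)) - k * x * (1 + x\<^sup>2) powr (- \<beta> / 2 - 1)"

lemma scaled_objective_deriv:
  fixes \<beta> k x :: real
  assumes "k \<noteq> 0"
  shows "(scaled_objective \<beta> k has_real_derivative
           k * (1 + x\<^sup>2) powr (- \<beta> / 2 - 2) * poly [:-1, \<beta> / k, 1 + \<beta>, \<beta> / k:] x) (at x)"
proof -
  have t: "1 + x\<^sup>2 > 0"
    by (simp add: add_pos_nonneg)
  define T where "T = (1 + x\<^sup>2) powr (- \<beta> / 2 - 2)"
  have "- \<beta> / 2 - 1 = (- \<beta> / 2 - 2) + 1"
    by simp
  then have p1: "(1 + x\<^sup>2) powr (- \<beta> / 2 - 1) = T * (1 + x\<^sup>2)"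
    unfolding T_def using t by (simp only: powr_add powr_one less_imp_le)
  have "(scaled_objective \<beta> k has_real_derivative
          - (- \<beta> / 2 * (1 + x\<^sup>2) powr (- \<beta> / 2 - 1) * (2 * x))
          - (k * (1 + x\<^sup>2) powr (- \<beta> / 2 - 1)
             + k * x * ((- \<beta> / 2 - 1) * (1 + x\<^sup>2) powr (- \<beta> / 2 - 2) * (2 * x)))) (at x)"
    unfolding scaled_objective_def[abs_def] using t
    by (auto intro!: derivative_eq_intros simp: algebra_simps)
  also have "- (- \<beta> / 2 * (1 + x\<^sup>2) powr (- \<beta> / 2 - 1) * (2 * x))
          - (k * (1 + x\<^sup>2) powr (- \<beta> / 2 - 1)
             + k * x * ((- \<beta> / 2 - 1) * (1 + x\<^sup>2) powr (- \<beta> / 2 - 2) * (2 * x)))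
        = k * T * poly [:-1, \<beta> / k, 1 + \<beta>, \<beta> / k:] x"
    unfolding p1 T_def[symmetric] using assms
    by (simp add: field_simps power2_eq_square)
  finally show ?thesis
    by (simp add: T_def)
qed

lemma scaled_objective_strict_min:
  fixes \<beta> k r x :: real
  assumes "k > 0" "r > 0"
    and neg: "\<And>x. 0 \<le> x \<Longrightarrow> x < r \<Longrightarrow> poly [:-1, \<beta> / k, 1 + \<beta>, \<beta> / k:] x < 0"
    and pos: "\<And>x. r < x \<Longrightarrow> poly [:-1, \<beta> / k, 1 + \<beta>, \<beta> / k:] x > 0"
    and "x \<noteq> r"
  shows "scaled_objective \<beta> k r < scaled_objective \<beta> k x"
proof -
  let ?f = "scaled_objective \<beta> k"
  have weight: "k * (1 + x\<^sup>2) powr (- \<beta> / 2 - 2) > 0" for x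
  proof -
    have "1 + x\<^sup>2 > 0" by (simp add: add_pos_nonneg)
    then show ?thesis using assms by simp
  qed
  have deriv: "(?f has_real_derivative
      k * (1 + x\<^sup>2) powr (- \<beta> / 2 - 2) * poly [:-1, \<beta> / k, 1 + \<beta>, \<beta> / k:] x) (at x)" for x
    using scaled_objective_deriv[of k \<beta> x] assms by simp
  have cont: "continuous_on S ?f" for S
    by (intro continuous_at_imp_continuous_on ballI) (rule DERIV_isCont[OF deriv])
  have nonneg: "?f r < ?f y" if "y \<ge> 0" "y \<noteq> r" for y
  proof (cases "y < r")
    case True
    show ?thesis
    proof (rule DERIV_neg_imp_decreasing_open[OF True _ cont])
      fix z assume "y < z" "z < r"
      then show "\<exists>d. (?f has_real_derivative d) (at z) \<and> d < 0"
        using deriv[of z] mult_pos_neg[OF weight neg] \<open>y \<ge> 0\<close> by fastforce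
    qed
  next
    case False
    then have "r < y" using that by simp
    then show ?thesis
    proof (rule DERIV_pos_imp_increasing_open[OF _ _ cont])
      fix z assume "r < z" "z < y"
      then show "\<exists>d. (?f has_real_derivative d) (at z) \<and> d > 0"
        using deriv[of z] mult_pos_pos[OF weight pos] by blast
    qed
  qed
  show ?thesis
  proof (cases "x \<ge> 0")
    case True
    then show ?thesis using nonneg assms by blast
  next
    case False
    have "?f \<bar>x\<bar> < ?f x"
    proof -
      have "1 + x\<^sup>2 > 0" by (simp add: add_pos_nonneg)
      then have "k * (1 + x\<^sup>2) powr (- \<beta> / 2 - 1) > 0" using assms by simp
      from mult_pos_neg[OF this, of x] False show ?thesis
        by (simp add: scaled_objective_def mult_ac)
    qed
    moreover have "?f r \<le> ?f \<bar>x\<bar>"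
      using nonneg[of "\<bar>x\<bar>"] by (cases "\<bar>x\<bar> = r") auto
    ultimately show ?thesis by linarith
  qed
qed

section \<open>The rational quadratic kernel\<close>

lemma kernel_deriv_rational_quadratic:
  fixes C :: "real \<Rightarrow> real" and \<sigma> \<beta> s h :: real
  assumes C: "\<And>h. h \<ge> 0 \<Longrightarrow> C h = \<sigma>\<^sup>2 * (1 + 2 * h / (\<beta> * s\<^sup>2)) powr (- \<beta> / 2)"
    and "\<beta> > 0" "s > 0" "h \<ge> 0"
  shows "kernel_deriv C h = - (\<sigma>\<^sup>2 / s\<^sup>2) * (1 + 2 * h / (\<beta> * s\<^sup>2)) powr (- \<beta> / 2 - 1)"
proof -
  let ?g = "\<lambda>h. \<sigma>\<^sup>2 * (1 + 2 * h / (\<beta> * s\<^sup>2)) powr (- \<beta> / 2)"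
  let ?t = "1 + 2 * h / (\<beta> * s\<^sup>2)"
  have t: "?t > 0"
    using assms by (intro add_pos_nonneg) auto
  have "(?g has_real_derivative
          \<sigma>\<^sup>2 * (- \<beta> / 2 * ?t powr (- \<beta> / 2 - 1) * (2 / (\<beta> * s\<^sup>2)))) (at h within {0..})"
    using t assms(2,3) by (auto intro!: derivative_eq_intros)
  also have "\<sigma>\<^sup>2 * (- \<beta> / 2 * ?t powr (- \<beta> / 2 - 1) * (2 / (\<beta> * s\<^sup>2)))
      = - (\<sigma>\<^sup>2 / s\<^sup>2) * ?t powr (- \<beta> / 2 - 1)"
    using assms by simp
  finally have "(?g has_vector_derivative - (\<sigma>\<^sup>2 / s\<^sup>2) * ?t powr (- \<beta> / 2 - 1))
      (at h within {0..})"
    by (simp add: has_real_derivative_iff_has_vector_derivative)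
  then have "(C has_vector_derivative - (\<sigma>\<^sup>2 / s\<^sup>2) * ?t powr (- \<beta> / 2 - 1)) (at h within {0..})"
    by (rule has_vector_derivative_transform[rotated 2]) (use C assms in auto)
  moreover have "at h within {0..} \<noteq> bot"
  proof -
    have "h islimpt {h..h + 1}" by (simp add: islimpt_Icc)
    then have "h islimpt {0..}" by (rule islimpt_subset) (use assms in auto)
    then show ?thesis by (simp add: trivial_limit_within)
  qed
  ultimately show ?thesis
    unfolding kernel_deriv_def by (intro vector_derivative_within)
qed

lemma rfd_objective_rational_quadratic:
  fixes C :: "real \<Rightarrow> real" and \<sigma> \<beta> s \<Theta> x :: real
  assumes C: "\<And>h. h \<ge> 0 \<Longrightarrow> C h = \<sigma>\<^sup>2 * (1 + 2 * h / (\<beta> * s\<^sup>2)) powr (- \<beta> / 2)"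
    and "\<beta> > 0" "s > 0" "\<sigma>\<^sup>2 > 0"
  shows "rfd_objective C \<Theta> (s * sqrt \<beta> * x) = scaled_objective \<beta> (\<Theta> * s * sqrt \<beta>) x"
proof -
  let ?\<eta> = "s * sqrt \<beta> * x"
  have scale: "1 + 2 * (?\<eta>\<^sup>2 / 2) / (\<beta> * s\<^sup>2) = 1 + x\<^sup>2"
    using assms by (simp add: power_mult_distrib)
  have "C (?\<eta>\<^sup>2 / 2) / C 0 = (1 + x\<^sup>2) powr (- \<beta> / 2)"
    using C[of "?\<eta>\<^sup>2 / 2"] C[of 0] assms scale by simp
  moreover have "kernel_deriv C (?\<eta>\<^sup>2 / 2) / kernel_deriv C 0 = (1 + x\<^sup>2) powr (- \<beta> / 2 - 1)"
    using kernel_deriv_rational_quadratic[OF C, where h = "?\<eta>\<^sup>2 / 2"]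
      kernel_deriv_rational_quadratic[OF C, where h = 0] assms scale by simp
  ultimately show ?thesis
    by (simp only: rfd_objective_def scaled_objective_def) (simp add: mult_ac)
qed

theorem theoremC4:
  fixes M :: "'w measure"
    and J :: "real ^ 'n \<Rightarrow> 'w \<Rightarrow> real"
    and C :: "real \<Rightarrow> real"
    and \<mu> \<sigma> \<beta> s \<Theta> :: real
    and p :: "real poly"
    and w :: "real ^ 'n"
    and \<omega> :: 'w
  assumes "\<Theta> = norm (gradient (\<lambda>x. J x \<omega>) w) / (\<mu> - J w \<omega>)"
    and "p = [:-1, sqrt \<beta> / (s * \<Theta>), 1 + \<beta>, sqrt \<beta> / (s * \<Theta>):]"
    and "prob_space M"
    and "isotropic_gaussian M J \<mu> C"
    and "\<beta> > 0" "s > 0" "\<sigma>\<^sup>2 > 0"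
    and "\<And>x y :: real ^ 'n. C ((norm (x - y))\<^sup>2 / 2)
           = \<sigma>\<^sup>2 * (1 + (norm (x - y))\<^sup>2 / (\<beta> * s\<^sup>2)) powr (- \<beta> / 2)"
    and "\<omega> \<in> space M"
    and "J w \<omega> < \<mu>"
    and "gradient (\<lambda>x. J x \<omega>) w \<noteq> 0"
  shows "\<Theta> > 0
    \<and> (\<exists>!x. x > 0 \<and> poly p x = 0)
    \<and> (\<forall>\<eta>. is_rfd_step_size C \<Theta> \<eta> \<longleftrightarrow> \<eta> = s * sqrt \<beta> * positive_root p)
    \<and> positive_root p \<in> {0 .. 1 / sqrt (1 + \<beta>)}"
proof -
  have \<Theta>: "\<Theta> > 0"
    using assms(1,10,11) by simp
  \<comment> \<open>The space has positive dimension, so every \<open>h \<ge> 0\<close> is half of a squared distance.\<close>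
  have C: "C h = \<sigma>\<^sup>2 * (1 + 2 * h / (\<beta> * s\<^sup>2)) powr (- \<beta> / 2)" if "h \<ge> 0" for h
  proof -
    have "0 \<le> sqrt (2 * h)" using that by simp
    then obtain x :: "real ^ 'n" where "norm x = sqrt (2 * h)"
      by (rule vector_choose_size)
    then show ?thesis
      using assms(8)[of x 0] that by simp
  qed
  define k where "k = \<Theta> * s * sqrt \<beta>"
  have k: "k > 0"
    using \<Theta> assms by (simp add: k_def)
  have "\<beta> / k = sqrt \<beta> / (s * \<Theta>)"
    using \<Theta> assms(5,6) by (simp add: k_def field_simps)
  then have p: "p = [:-1, \<beta> / k, 1 + \<beta>, \<beta> / k:]"
    using assms(2) by simp
  have "\<beta> / k > 0" "1 + \<beta> > 0"
    using k assms(5) by simp_all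
  then obtain r where r: "0 < r" "r < 1 / sqrt (1 + \<beta>)" "poly p r = 0"
    and neg: "\<And>x. 0 \<le> x \<Longrightarrow> x < r \<Longrightarrow> poly p x < 0"
    and pos: "\<And>x. r < x \<Longrightarrow> poly p x > 0"
    unfolding p by (rule cubic_sign_change) blast
  have root_unique: "x = r" if "x > 0" "poly p x = 0" for x
    using that neg[of x] pos[of x] by (cases x r rule: linorder_cases) auto
  have ex1: "\<exists>!x. x > 0 \<and> poly p x = 0"
    using r root_unique by blast
  have root: "positive_root p = r"
    unfolding positive_root_def using r root_unique by blast
  have strict: "rfd_objective C \<Theta> (s * sqrt \<beta> * r) < rfd_objective C \<Theta> \<eta>"
    if "\<eta> \<noteq> s * sqrt \<beta> * r" for \<eta>
  proof -
    define x where "x = \<eta> / (s * sqrt \<beta>)"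
    have \<eta>: "\<eta> = s * sqrt \<beta> * x"
      using assms(5,6) by (simp add: x_def)
    with that have "x \<noteq> r" by auto
    have "scaled_objective \<beta> k r < scaled_objective \<beta> k x"
      by (rule scaled_objective_strict_min[OF k r(1) neg[unfolded p] pos[unfolded p] \<open>x \<noteq> r\<close>])
    then show ?thesis
      unfolding \<eta> k_def using rfd_objective_rational_quadratic[OF C assms(5-7)] by simp
  qed
  have "is_rfd_step_size C \<Theta> \<eta> \<longleftrightarrow> \<eta> = s * sqrt \<beta> * r" for \<eta>
    unfolding is_rfd_step_size_def is_arg_min_def using strict by (metis less_asym)
  then show ?thesis
    using \<Theta> ex1 r root by simp
qed

end
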